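(* Let $k,w,s\in\mathbb Z_{>0}$. The hook products satisfy \[ \frac{H_{\delta_{k+1}^{(w,s)}}}{H_{\delta_k^{(w,s)}}} = \prod_{r=0}^{k-1}\prod_{i=1}^{s}\prod_{j=1}^{w} \bigl(s-i+j+(w+s)r\bigr). \] The corresponding standard tableau counts satisfy \[ \frac{f^{\delta_{k+1}^{(w,s)}}}{f^{\delta_k^{(w,s)}}} =\frac{\left(\frac{ws\,k(k+1)}{2}\right)!} {\left(\frac{ws\,k(k-1)}{2}\right)!} \prod_{r=0}^{k-1}\prod_{i=1}^{s}\prod_{j=1}^{w} \frac{1}{s-i+j+(w+s)r}. \]
   Context: A partition $\lambda$ is identified with its Young diagram $\{(i,j)\in\mathbb Z_{>0}^2:1\le j\le\lambda_i\}$; the conjugate is $\lambda'_j=|\{i:\lambda_i\ge j\}|$. Exponents on parts denote multiplicities. For a box $u=(i,j)\in\lambda$, the arm length is $a_\lambda(u)=\lambda_i-j$ and the leg length is $l_\lambda(u)=\lambda'_j-i$. The hook product is $H_\lambda=\prod_{u\in\lambda}(a_\lambda(u)+l_\lambda(u)+1)$, and $f^\lambda$ is the number of standard Young tableaux of shape $\lambda$. Empty products equal $1$; $H_\varnothing=f^\varnothing=1$. Generalized staircase partitions: for $w,s\in\mathbb Z_{>0}$, $\delta_1^{(w,s)}=\varnothing$ and, for $k\ge2$, $\delta_k^{(w,s)}=\bigl((w(k-1))^s,(w(k-2))^s,\ldots,w^s\bigr)$. *)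

theory Defs
  imports Complex_Main "HOL-Library.FuncSet"
begin

text \<open>A partition is the list of its (positive) parts in weakly decreasing order.
  Parts, rows and columns are numbered from 1, and \<open>part lam i = 0\<close> beyond the last part.\<close>

definition is_partition :: "nat list \<Rightarrow> bool" where
  "is_partition lam \<longleftrightarrow> sorted_wrt (\<ge>) lam \<and> 0 \<notin> set lam"

definition part :: "nat list \<Rightarrow> nat \<Rightarrow> nat" where
  "part lam i = (if 1 \<le> i \<and> i \<le> length lam then lam ! (i - 1) else 0)"

definition young_diagram :: "nat list \<Rightarrow> (nat \<times> nat) set" where
  "young_diagram lam = {(i, j). 1 \<le> i \<and> 1 \<le> j \<and> j \<le> part lam i}"

text \<open>Only meaningful for \<open>j \<ge> 1\<close>: the set is infinite for \<open>j = 0\<close>.\<close>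

definition conj_part :: "nat list \<Rightarrow> nat \<Rightarrow> nat" where
  "conj_part lam j = card {i. 1 \<le> i \<and> j \<le> part lam i}"

text \<open>The truncated subtractions are exact for boxes of the diagram of a partition.\<close>

definition arm :: "nat list \<Rightarrow> nat \<times> nat \<Rightarrow> nat" where
  "arm lam u = part lam (fst u) - snd u"

definition leg :: "nat list \<Rightarrow> nat \<times> nat \<Rightarrow> nat" where
  "leg lam u = conj_part lam (snd u) - fst u"

definition hook_product :: "nat list \<Rightarrow> nat" where
  "hook_product lam = (\<Prod>u\<in>young_diagram lam. arm lam u + leg lam u + 1)"

text \<open>Tableaux are functions on boxes, made \<^const>\<open>undefined\<close> outside the diagram
  so that each filling is counted exactly once.\<close>

definition standard_tableaux :: "nat list \<Rightarrow> (nat \<times> nat \<Rightarrow> nat) set" where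
  "standard_tableaux lam =
    {T \<in> extensional (young_diagram lam).
       bij_betw T (young_diagram lam) {1..sum_list lam} \<and>
       (\<forall>i j j'. (i, j) \<in> young_diagram lam \<and> (i, j') \<in> young_diagram lam \<and> j < j'
          \<longrightarrow> T (i, j) < T (i, j')) \<and>
       (\<forall>i i' j. (i, j) \<in> young_diagram lam \<and> (i', j) \<in> young_diagram lam \<and> i < i'
          \<longrightarrow> T (i, j) < T (i', j))}"

definition num_SYT :: "nat list \<Rightarrow> nat" where
  "num_SYT lam = card (standard_tableaux lam)"

definition gen_staircase :: "nat \<Rightarrow> nat \<Rightarrow> nat \<Rightarrow> nat list" where
  "gen_staircase w s k = concat (map (\<lambda>m. replicate s (w * m)) (rev [1..<k]))"

lemma gen_staircase_1: "gen_staircase w s 1 = []"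
  by (simp add: gen_staircase_def)

lemma gen_staircase_Suc:
  "k \<ge> 1 \<Longrightarrow> gen_staircase w s (Suc k) = replicate s (w * k) @ gen_staircase w s k"
  by (simp add: gen_staircase_def)

lemma is_partition_gen_staircase:
  assumes "w > 0"
  shows "is_partition (gen_staircase w s k)"
proof -
  have rep: "sorted_wrt (\<ge>) (replicate n (x::nat))" for n x
    by (induction n) auto
  have "sorted_wrt (\<ge>) (gen_staircase w s k) \<and> (\<forall>x\<in>set (gen_staircase w s k). 0 < x \<and> x \<le> w * k)"
  proof (induction k)
    case 0
    then show ?case by (simp add: gen_staircase_def)
  next
    case (Suc k)
    show ?case
    proof (cases "k = 0")
      case True
      then show ?thesis by (simp add: gen_staircase_def)
    next
      case False
      then show ?thesis
        using Suc assms rep by (fastforce simp: gen_staircase_Suc sorted_wrt_append)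
    qed
  qed
  then show ?thesis by (auto simp: is_partition_def)
qed

end

theory Submission
  imports Defs
begin

text \<open>
  The second ratio follows from the first once the hook length formula
  \<open>f H = n!\<close> is known (\<open>hook_length_formula\<close>): the two staircases have
  \<open>w s k (k + 1) / 2\<close> and \<open>w s k (k - 1) / 2\<close> boxes.

  The hook length formula is proved by induction on the number \<open>n\<close> of boxes.
  Deleting the largest entry of a standard tableau gives the branching rule, by which
  \<open>f\<close> of a shape is the sum of the \<open>f\<close> of the shapes with one corner removed
  (\<open>num_SYT_branching\<close>). It remains to see that the quotients
  \<open>H / H'\<close>, with \<open>H'\<close> the hook product after removing a corner, add up to \<open>n\<close>
  over all corners (\<open>sum_hook_product_remove_box\<close>).

  For this the hook product is written in terms of the beta numbers
  \<open>x\<^sub>i = \<lambda>\<^sub>i + m - i\<close> of a shape with \<open>m\<close> rows: in each row the hook lengths and the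
  differences \<open>x\<^sub>i - x\<^sub>j\<close> with \<open>j > i\<close> together exhaust \<open>1, \<dots>, x\<^sub>i\<close>, so
  \<open>H\<close> is the product of the \<open>x\<^sub>i!\<close> divided by the Vandermonde product
  (\<open>hook_product_beta_number\<close>). Removing a box from row \<open>i\<close> lowers \<open>x\<^sub>i\<close> by one, so
  \<open>H / H' = x\<^sub>i A\<^sub>i\<close>, where \<open>A\<^sub>i\<close> is the product of the \<open>(x\<^sub>i - 1 - x\<^sub>j) / (x\<^sub>i - x\<^sub>j)\<close>
  over \<open>j \<noteq> i\<close>. These \<open>A\<^sub>i\<close> are, up to sign, the coefficients in the partial fraction expansion of
  the rational function \<open>\<Prod>\<^sub>j (z - 1 - x\<^sub>j) / (z - x\<^sub>j)\<close>, which makes the sum of the \<open>x\<^sub>i A\<^sub>i\<close>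
  computable (\<open>sum_shift_quotient\<close>). The value is \<open>\<Sum> x\<^sub>i - m (m - 1) / 2 = n\<close>.

  The first ratio is a direct count. The staircase with index \<open>k + 1\<close> is the one with index
  \<open>k\<close> with \<open>s\<close> rows of length \<open>w k\<close> placed on top, and adding rows on top leaves
  the hooks below unchanged. The quotient is therefore the product of the
  hooks in the new rows, cut into \<open>k\<close> blocks of \<open>w\<close> columns; with the blocks
  numbered from the right, starting with 0, each column of block \<open>r\<close> contains exactly
  \<open>s r\<close> boxes of the smaller staircase.

  The induction works with weakly decreasing lists that may end in zeros, so that
  removing a box never changes the number of rows.
\<close>

section \<open>Partial fractions and Vandermonde products\<close>

definition shift_quotient :: "('a \<Rightarrow> real) \<Rightarrow> 'a set \<Rightarrow> real \<Rightarrow> real" where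
  "shift_quotient x I z = (\<Prod>j\<in>I. (z - 1 - x j) / (z - x j))"

lemma shift_quotient_insert:
  assumes "finite I" "a \<notin> I" "z \<noteq> x a"
  shows "shift_quotient x (insert a I) z = (1 - 1 / (z - x a)) * shift_quotient x I z"
proof -
  have "(z - 1 - x a) / (z - x a) = 1 - 1 / (z - x a)"
    using assms(3) by (simp add: divide_simps)
  then show ?thesis using assms(1,2) by (simp add: shift_quotient_def)
qed

text \<open>The shift quotient is a rational function of \<open>z\<close> with value 1 at infinity and at most simple
  poles, whose residue at \<open>x i\<close> is minus the product of the remaining factors at \<open>z = x i\<close>.
  The induction multiplies the expansion by one more factor \<open>1 - 1 / (z - x a)\<close> and splits each
  product of two poles; the coefficient at the new pole \<open>x a\<close> comes from the induction hypothesis at \<open>z = x a\<close>.\<close>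

lemma shift_quotient_partial_fractions:
  assumes "finite I" "inj_on x I" "z \<notin> x ` I"
  shows "shift_quotient x I z = 1 - (\<Sum>i\<in>I. shift_quotient x (I - {i}) (x i) / (z - x i))"
  using assms
proof (induction I arbitrary: z rule: finite_induct)
  case empty
  then show ?case by (simp add: shift_quotient_def)
next
  case (insert a I)
  let ?A = "\<lambda>i. shift_quotient x (I - {i}) (x i)"
  have inj: "inj_on x I" and xa: "x a \<notin> x ` I" and z: "z \<notin> x ` I" "z \<noteq> x a"
    using insert by auto
  have A': "shift_quotient x (insert a I - {i}) (x i) = (1 - 1 / (x i - x a)) * ?A i" if "i \<in> I" for i
  proof -
    have "insert a I - {i} = insert a (I - {i})" using that insert by auto
    moreover have "x i \<noteq> x a" using that xa by (metis imageI)
    ultimately show ?thesis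
      using shift_quotient_insert[of "I - {i}" a "x i" x] insert.hyps by simp
  qed
  have Aa: "shift_quotient x I (x a) = 1 - (\<Sum>i\<in>I. ?A i / (x a - x i))"
    by (rule insert.IH[OF inj xa])
  have pf: "?A i / (z - x i) * (1 / (z - x a))
      = ?A i / (x i - x a) / (z - x i) + ?A i / (x a - x i) / (z - x a)" if "i \<in> I" for i
  proof -
    have "x i \<noteq> x a" "z \<noteq> x i" using that xa z by (metis imageI)+
    then have "1 / (z - x i) * (1 / (z - x a))
        = 1 / (x i - x a) / (z - x i) + 1 / (x a - x i) / (z - x a)"
      using z(2) by (simp add: divide_simps) (simp add: algebra_simps)
    then have "?A i * (1 / (z - x i) * (1 / (z - x a)))
        = ?A i * (1 / (x i - x a) / (z - x i) + 1 / (x a - x i) / (z - x a))" by simp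
    then show ?thesis by (simp add: distrib_left)
  qed
  have "shift_quotient x (insert a I) z
      = (1 - 1 / (z - x a)) * (1 - (\<Sum>i\<in>I. ?A i / (z - x i)))"
    using shift_quotient_insert[of I a z x] insert.IH[OF inj z(1)] insert.hyps z by auto
  also have "\<dots> = 1 - 1 / (z - x a) - (\<Sum>i\<in>I. ?A i / (z - x i))
      + (\<Sum>i\<in>I. ?A i / (z - x i) * (1 / (z - x a)))"
    unfolding sum_distrib_right[symmetric] by (simp add: algebra_simps)
  also have "(\<Sum>i\<in>I. ?A i / (z - x i) * (1 / (z - x a)))
      = (\<Sum>i\<in>I. ?A i / (x i - x a) / (z - x i)) + (\<Sum>i\<in>I. ?A i / (x a - x i)) / (z - x a)"
    unfolding sum_divide_distrib sum.distrib[symmetric] by (rule sum.cong[OF refl]) (rule pf)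
  also have "1 - 1 / (z - x a) - (\<Sum>i\<in>I. ?A i / (z - x i)) + \<dots>
      = 1 - (\<Sum>i\<in>insert a I. shift_quotient x (insert a I - {i}) (x i) / (z - x i))"
    using insert.hyps
    by (simp add: Aa A' left_diff_distrib diff_divide_distrib sum_subtractf cong: sum.cong)
  finally show ?case .
qed

text \<open>The sums are, up to sign, the coefficients of \<open>1 / z\<close> and \<open>1 / z\<^sup>2\<close> in the shift quotient at
  infinity.
  Both are computed together by adding one pole \<open>x a\<close> at a time: every old coefficient \<open>A\<^sub>i\<close>
  gains \<open>A\<^sub>i / (x a - x i)\<close>, and by the expansion at \<open>z = x a\<close> the new coefficient is
  one minus the sum of these gains.\<close>

lemma sum_shift_quotient:
  assumes "finite I" "inj_on x I"
  shows "(\<Sum>i\<in>I. shift_quotient x (I - {i}) (x i)) = real (card I)"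
    and "(\<Sum>i\<in>I. x i * shift_quotient x (I - {i}) (x i))
         = (\<Sum>i\<in>I. x i) - real (card I * (card I - 1)) / 2"
proof -
  have "(\<Sum>i\<in>I. shift_quotient x (I - {i}) (x i)) = real (card I) \<and>
    (\<Sum>i\<in>I. x i * shift_quotient x (I - {i}) (x i))
         = (\<Sum>i\<in>I. x i) - real (card I * (card I - 1)) / 2"
    using assms
  proof (induction I rule: finite_induct)
    case empty
    then show ?case by simp
  next
    case (insert a I)
    let ?A = "\<lambda>i. shift_quotient x (I - {i}) (x i)"
    have inj: "inj_on x I" and xa: "x a \<notin> x ` I" using insert by auto
    note IH = conjunct1[OF insert.IH[OF inj]] conjunct2[OF insert.IH[OF inj]]
    have A': "shift_quotient x (insert a I - {i}) (x i) = ?A i + ?A i / (x a - x i)" if "i \<in> I" for i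
    proof -
      have "insert a I - {i} = insert a (I - {i})" using that insert by auto
      moreover have "x i \<noteq> x a" using that xa by (metis imageI)
      ultimately show ?thesis
        using shift_quotient_insert[of "I - {i}" a "x i" x] insert.hyps
        by (simp add: divide_simps) (simp add: algebra_simps)
    qed
    have Aa: "shift_quotient x I (x a) = 1 - (\<Sum>i\<in>I. ?A i / (x a - x i))"
      by (rule shift_quotient_partial_fractions[OF insert.hyps(1) inj xa])
    have "x i * (?A i / (x a - x i)) = x a * (?A i / (x a - x i)) - ?A i" if "i \<in> I" for i
    proof -
      have "x i \<noteq> x a" using that xa by (metis imageI)
      then show ?thesis by (simp add: divide_simps) (simp add: algebra_simps)
    qed
    then have w: "(\<Sum>i\<in>I. x i * (?A i / (x a - x i)))
        = x a * (\<Sum>i\<in>I. ?A i / (x a - x i)) - real (card I)"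
      unfolding sum_distrib_left IH(1)[symmetric] by (simp add: sum_subtractf cong: sum.cong)
    have c: "real (card (insert a I) * (card (insert a I) - 1)) / 2
        = real (card I * (card I - 1)) / 2 + real (card I)"
      using insert.hyps by (cases "card I") (simp_all add: field_simps)
    have s1: "(\<Sum>i\<in>insert a I. shift_quotient x (insert a I - {i}) (x i))
        = 1 + (\<Sum>i\<in>I. ?A i)"
      using insert.hyps by (simp add: Aa A' sum.distrib cong: sum.cong)
    have "(\<Sum>i\<in>insert a I. x i * shift_quotient x (insert a I - {i}) (x i))
        = x a * (1 - (\<Sum>i\<in>I. ?A i / (x a - x i)))
          + (\<Sum>i\<in>I. x i * ?A i + x i * (?A i / (x a - x i)))"
      using insert.hyps by (simp add: Aa A' distrib_left cong: sum.cong)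
    also have "\<dots> = x a + (\<Sum>i\<in>I. x i * ?A i) - real (card I)"
      unfolding sum.distrib w by (simp add: algebra_simps)
    finally have s2: "(\<Sum>i\<in>insert a I. x i * shift_quotient x (insert a I - {i}) (x i))
        = x a + (\<Sum>i\<in>I. x i * ?A i) - real (card I)" .
    show ?case unfolding s1 s2 c IH using insert.hyps by simp
  qed
  then show "(\<Sum>i\<in>I. shift_quotient x (I - {i}) (x i)) = real (card I)"
    and "(\<Sum>i\<in>I. x i * shift_quotient x (I - {i}) (x i))
         = (\<Sum>i\<in>I. x i) - real (card I * (card I - 1)) / 2" by auto
qed

definition vandermonde :: "nat \<Rightarrow> (nat \<Rightarrow> real) \<Rightarrow> real" where
  "vandermonde m x = (\<Prod>b<m. \<Prod>a<b. x a - x b)"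

text \<open>Only the factors that involve \<open>x i\<close> change. Reordering the differences so that \<open>x i\<close> comes
  first produces the same sign on both sides.\<close>

lemma vandermonde_fun_upd:
  assumes "i < m"
  shows "vandermonde m (x(i := y)) * (\<Prod>j\<in>{..<m} - {i}. x i - x j)
       = vandermonde m x * (\<Prod>j\<in>{..<m} - {i}. y - x j)"
  using assms
proof (induction m)
  case 0
  then show ?case by simp
next
  case (Suc m)
  show ?case
  proof (cases "i = m")
    case True
    have neg: "(\<Prod>a<m. x a - v) = (-1) ^ m * (\<Prod>a<m. v - x a)" for v
    proof -
      have "(\<Prod>a<m. x a - v) = (\<Prod>a<m. (-1) * (v - x a))" by simp
      then show ?thesis by (simp only: prod.distrib prod_constant) simp
    qed
    have "vandermonde m (x(m := y)) = vandermonde m x"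
      by (auto simp: vandermonde_def intro!: prod.cong)
    moreover have "{..<Suc m} - {m} = {..<m}" by auto
    moreover have "(\<Prod>a<m. (x(m := y)) a - y) = (\<Prod>a<m. x a - y)"
      by (auto intro!: prod.cong)
    ultimately show ?thesis using True neg[of y] neg[of "x m"]
      by (simp add: vandermonde_def)
  next
    case False
    then have i: "i < m" using Suc by simp
    have s: "{..<Suc m} - {i} = insert m ({..<m} - {i})" using i by auto
    have "(\<Prod>a<m. (x(i := y)) a - x m) = (y - x m) * (\<Prod>a\<in>{..<m} - {i}. x a - x m)"
      using i by (subst prod.remove[of _ i]) (auto intro!: prod.cong)
    moreover have "(\<Prod>a<m. x a - x m) = (x i - x m) * (\<Prod>a\<in>{..<m} - {i}. x a - x m)"
      using i by (subst prod.remove[of _ i]) auto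
    ultimately show ?thesis using Suc.IH[OF i] False i
      by (simp add: vandermonde_def s)
  qed
qed

lemma vandermonde_Suc_shift:
  "vandermonde (Suc m) x = (\<Prod>b<m. x 0 - x (Suc b)) * vandermonde m (\<lambda>a. x (Suc a))"
proof -
  have "vandermonde (Suc m) x = (\<Prod>b<m. \<Prod>a<Suc b. x a - x (Suc b))"
    by (simp only: vandermonde_def prod.lessThan_Suc_shift[of _ m]) simp
  also have "\<dots> = (\<Prod>b<m. (x 0 - x (Suc b)) * (\<Prod>a<b. x (Suc a) - x (Suc b)))"
    by (rule prod.cong[OF refl]) (rule prod.lessThan_Suc_shift)
  finally show ?thesis by (simp only: prod.distrib vandermonde_def)
qed

lemma vandermonde_pos:
  assumes "\<And>a b. a < b \<Longrightarrow> b < m \<Longrightarrow> x b < x a"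
  shows "0 < vandermonde m x"
  using assms by (auto simp: vandermonde_def intro!: prod_pos)

section \<open>Hooks\<close>

lemma part_Cons: "part (x # xs) (Suc i) = (if i = 0 then x else part xs i)"
  by (cases i) (auto simp: part_def)

lemma finite_young_diagram: "finite (young_diagram lam)"
proof (rule finite_subset)
  show "young_diagram lam \<subseteq> {1..length lam} \<times> {1..sum_list lam}"
  proof clarify
    fix i j
    assume "(i, j) \<in> young_diagram lam"
    then have ij: "1 \<le> i" "i \<le> length lam" "1 \<le> j" "j \<le> lam ! (i - 1)"
      by (auto simp: young_diagram_def part_def split: if_splits)
    then have "lam ! (i - 1) \<le> sum_list lam" by (intro member_le_sum_list) auto
    then show "i \<in> {1..length lam} \<and> j \<in> {1..sum_list lam}" using ij by auto
  qed
qed auto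

lemma conj_part_eq_filter:
  assumes "1 \<le> j"
  shows "conj_part lam j = length (filter (\<lambda>x. j \<le> x) lam)"
proof -
  have "{i. 1 \<le> i \<and> j \<le> part lam i} = Suc ` {i. i < length lam \<and> j \<le> lam ! i}"
    using assms by (force simp: part_def image_iff gr0_conv_Suc Suc_le_eq)
  then show ?thesis
    by (simp add: conj_part_def card_image length_filter_conv_card)
qed

lemma young_diagram_Cons:
  "young_diagram (x # xs) = Pair 1 ` {1..x} \<union> map_prod Suc id ` young_diagram xs"
proof -
  have "p \<in> young_diagram (x # xs) \<longleftrightarrow> p \<in> Pair 1 ` {1..x} \<union> map_prod Suc id ` young_diagram xs" for p
  proof (cases p)
    case (Pair a b)
    show ?thesis
    proof (cases a)
      case 0
      then show ?thesis using Pair by (auto simp: young_diagram_def)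
    next
      case (Suc i)
      have "p \<in> map_prod Suc id ` young_diagram xs \<longleftrightarrow> (i, b) \<in> young_diagram xs"
        using Pair Suc by (force simp: image_iff)
      then show ?thesis using Pair Suc
        by (auto simp: young_diagram_def part_Cons)
    qed
  qed
  then show ?thesis by blast
qed

text \<open>Placing a longest row on top changes neither arm nor leg of the boxes below it.\<close>

lemma hook_product_Cons:
  assumes "\<And>y. y \<in> set xs \<Longrightarrow> y \<le> x"
  shows "hook_product (x # xs) = (\<Prod>j=1..x. x - j + conj_part xs j + 1) * hook_product xs"
proof -
  let ?h = "\<lambda>u. arm (x # xs) u + leg (x # xs) u + 1"
  have row: "prod ?h (Pair 1 ` {1..x}) = (\<Prod>j=1..x. x - j + conj_part xs j + 1)"
    by (subst prod.reindex)
       (auto simp: inj_on_def arm_def leg_def conj_part_eq_filter part_def intro!: prod.cong)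
  have "?h (map_prod Suc id u) = arm xs u + leg xs u + 1" if "u \<in> young_diagram xs" for u
  proof -
    obtain i j where u: "u = (i, j)" by (cases u)
    have ij: "1 \<le> i" "1 \<le> j" "j \<le> part xs i" using that u by (auto simp: young_diagram_def)
    then have "part xs i \<in> set xs" by (auto simp: part_def split: if_splits)
    with ij assms have "j \<le> x" by force
    then show ?thesis using ij u by (simp add: arm_def leg_def conj_part_eq_filter part_Cons)
  qed
  then have rest: "prod ?h (map_prod Suc id ` young_diagram xs) = hook_product xs"
    by (subst prod.reindex) (auto simp: inj_on_def hook_product_def intro!: prod.cong)
  have "Pair 1 ` {1..x} \<inter> map_prod Suc id ` young_diagram xs = {}"
    by (auto simp: young_diagram_def)
  then show ?thesis unfolding hook_product_def young_diagram_Cons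
    by (subst prod.union_disjoint)
       (use row rest in \<open>auto simp: finite_young_diagram hook_product_def\<close>)
qed

text \<open>This duality between rows and columns separates the hook lengths of the first row from
  the differences of beta numbers in the next lemma.\<close>

lemma conj_part_le_iff:
  assumes "sorted_wrt (\<ge>) xs" "1 \<le> j" "k < length xs"
  shows "conj_part xs j \<le> k \<longleftrightarrow> xs ! k < j"
proof -
  have mono: "xs ! b \<le> xs ! a" if "a \<le> b" "b < length xs" for a b
    using assms(1) that by (cases "a = b") (auto simp: sorted_wrt_iff_nth_less)
  have c: "conj_part xs j = card {i. i < length xs \<and> j \<le> xs ! i}"
    using assms by (simp add: conj_part_eq_filter length_filter_conv_card)
  show ?thesis
  proof (cases "xs ! k < j")
    case True
    then have "{i. i < length xs \<and> j \<le> xs ! i} \<subseteq> {..<k}"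
      using mono by (force simp: not_le[symmetric])
    then have "card {i. i < length xs \<and> j \<le> xs ! i} \<le> card {..<k}" by (intro card_mono) auto
    then show ?thesis using True c by simp
  next
    case False
    then have "{..k} \<subseteq> {i. i < length xs \<and> j \<le> xs ! i}"
      using mono assms(3) by force
    then have "card {..k} \<le> card {i. i < length xs \<and> j \<le> xs ! i}" by (intro card_mono) auto
    then show ?thesis using False c by simp
  qed
qed

text \<open>Along the top row the hook lengths strictly decrease, and the
  differences \<open>x + 1 + k - xs ! k\<close> strictly increase. A value common to both would give
  \<open>conj_part xs j + xs ! k = k + j\<close>, but the left side is larger if \<open>j \<le> xs ! k\<close> and smaller
  otherwise. So these \<open>x + length xs\<close> numbers are distinct, and being at most
  \<open>x + length xs\<close> and positive they are exactly \<open>1, \<dots>, x + length xs\<close>.\<close>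

lemma first_row_hooks:
  assumes "sorted_wrt (\<ge>) (x # xs)"
  shows "(\<Prod>j=1..x. x - j + conj_part xs j + 1) * (\<Prod>k<length xs. x + 1 + k - xs ! k)
         = fact (x + length xs)"
proof -
  let ?m = "length xs"
  let ?h = "\<lambda>j. x - j + conj_part xs j + 1" and ?g = "\<lambda>k. x + 1 + k - xs ! k"
  have sxs: "sorted_wrt (\<ge>) xs" and le: "\<And>k. k < ?m \<Longrightarrow> xs ! k \<le> x" using assms by auto
  have cm: "conj_part xs j' \<le> conj_part xs j" if "1 \<le> j" "j \<le> j'" for j j'
    using that by (auto simp: conj_part_eq_filter length_filter_conv_card intro!: card_mono)
  have cl: "conj_part xs j \<le> ?m" if "1 \<le> j" for j
    using that by (simp add: conj_part_eq_filter)
  have "?h j' < ?h j" if "j < j'" "j \<in> {1..x}" "j' \<in> {1..x}" for j j'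
    using cm[of j j'] that by auto
  then have injh: "inj_on ?h {1..x}"
    by (metis (no_types, lifting) inj_onI linorder_neqE_nat less_irrefl)
  have "?g k < ?g k'" if "k < k'" "k \<in> {..<?m}" "k' \<in> {..<?m}" for k k'
  proof -
    have "xs ! k' \<le> xs ! k" using that sxs by (auto simp: sorted_wrt_iff_nth_less)
    then show ?thesis using le[of k] le[of k'] that by auto
  qed
  then have injg: "inj_on ?g {..<?m}"
    by (metis (no_types, lifting) inj_onI linorder_neqE_nat less_irrefl)
  have ne: "?h j \<noteq> ?g k" if "j \<in> {1..x}" "k \<in> {..<?m}" for j k
    using conj_part_le_iff[OF sxs, of j k] le[of k] that by (cases "xs ! k < j") auto
  then have disj: "?h ` {1..x} \<inter> ?g ` {..<?m} = {}" by auto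
  have "?h ` {1..x} \<union> ?g ` {..<?m} = {1..x + ?m}"
  proof (rule card_subset_eq)
    show "?h ` {1..x} \<union> ?g ` {..<?m} \<subseteq> {1..x + ?m}"
    proof -
      have "?h j \<in> {1..x + ?m}" if "j \<in> {1..x}" for j using cl[of j] that by auto
      moreover have "?g k \<in> {1..x + ?m}" if "k \<in> {..<?m}" for k using le[of k] that by auto
      ultimately show ?thesis by blast
    qed
    show "card (?h ` {1..x} \<union> ?g ` {..<?m}) = card {1..x + ?m}"
      using disj card_image[OF injh] card_image[OF injg] by (subst card_Un_disjoint) simp_all
  qed simp
  then have "fact (x + ?m) = prod id (?h ` {1..x} \<union> ?g ` {..<?m})"
    by (simp add: fact_prod)
  also have "\<dots> = prod id (?h ` {1..x}) * prod id (?g ` {..<?m})"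
    using disj by (intro prod.union_disjoint) auto
  also have "\<dots> = prod ?h {1..x} * prod ?g {..<?m}"
    using prod.reindex[OF injh, of id] prod.reindex[OF injg, of id] by simp
  finally show ?thesis by simp
qed

definition beta_number :: "nat list \<Rightarrow> nat \<Rightarrow> nat" where
  "beta_number lam i = lam ! i + (length lam - Suc i)"

lemma beta_number_strict_decreasing:
  assumes "sorted_wrt (\<ge>) lam" "a < b" "b < length lam"
  shows "beta_number lam b < beta_number lam a"
proof -
  have "lam ! b \<le> lam ! a" using assms by (auto simp: sorted_wrt_iff_nth_less)
  then show ?thesis using assms by (simp add: beta_number_def)
qed

text \<open>One factor \<open>first_row_hooks\<close> for each row: the differences occurring there are those
  between the beta number of the row and the beta numbers of the rows below.\<close>

lemma hook_product_beta_number: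
  assumes "sorted_wrt (\<ge>) lam"
  shows "real (hook_product lam) * vandermonde (length lam) (\<lambda>i. real (beta_number lam i))
         = (\<Prod>i<length lam. fact (beta_number lam i))"
  using assms
proof (induction lam)
  case Nil
  have "young_diagram [] = {}" by (auto simp: young_diagram_def part_def)
  then show ?case by (simp add: hook_product_def vandermonde_def)
next
  case (Cons x xs)
  let ?m = "length xs"
  have le: "\<And>k. k < ?m \<Longrightarrow> xs ! k \<le> x" using Cons.prems by auto
  have b0: "beta_number (x # xs) 0 = x + ?m" and bS: "\<And>a. beta_number (x # xs) (Suc a) = beta_number xs a"
    by (simp_all add: beta_number_def)
  have "real (beta_number (x # xs) 0) - real (beta_number xs k) = real (x + 1 + k - xs ! k)" if "k < ?m" for k
    using le[OF that] that by (simp add: b0 beta_number_def of_nat_diff)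
  then have d: "(\<Prod>k<?m. real (beta_number (x # xs) 0) - real (beta_number xs k))
      = real (\<Prod>k<?m. x + 1 + k - xs ! k)"
    by (simp add: of_nat_prod)
  have "real (hook_product (x # xs)) * vandermonde (length (x # xs)) (\<lambda>i. real (beta_number (x # xs) i))
     = real ((\<Prod>j=1..x. x - j + conj_part xs j + 1) * (\<Prod>k<?m. x + 1 + k - xs ! k))
       * (real (hook_product xs) * vandermonde ?m (\<lambda>i. real (beta_number xs i)))"
    using Cons.prems d by (simp add: hook_product_Cons vandermonde_Suc_shift bS)
  also have "\<dots> = fact (x + ?m) * (\<Prod>i<?m. fact (beta_number xs i))"
    using first_row_hooks[OF Cons.prems] Cons by simp
  finally show ?case by (simp add: prod.lessThan_Suc_shift b0 bS del: prod.lessThan_Suc)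
qed

lemma hook_product_pos: "0 < hook_product lam"
  by (auto simp: hook_product_def intro!: prod_pos)

section \<open>Removing a corner\<close>

text \<open>Rows are counted from 0 here, so row \<open>i\<close> of the list is row \<open>Suc i\<close> of the diagram.\<close>

definition corner_rows :: "nat list \<Rightarrow> nat set" where
  "corner_rows lam = {i. i < length lam \<and> 0 < lam ! i \<and>
     (Suc i < length lam \<longrightarrow> lam ! Suc i < lam ! i)}"

definition remove_box :: "nat list \<Rightarrow> nat \<Rightarrow> nat list" where
  "remove_box lam i = lam[i := lam ! i - 1]"

lemma sorted_remove_box:
  assumes "sorted_wrt (\<ge>) lam" "i \<in> corner_rows lam"
  shows "sorted_wrt (\<ge>) (remove_box lam i)"
proof -
  have "lam ! b < lam ! i" if "i < b" "b < length lam" for b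
  proof -
    have "lam ! Suc i < lam ! i" using that assms(2) by (auto simp: corner_rows_def)
    moreover have "lam ! b \<le> lam ! Suc i"
      using that assms(1) by (cases "b = Suc i") (auto simp: sorted_wrt_iff_nth_less)
    ultimately show ?thesis by simp
  qed
  then have "remove_box lam i ! b \<le> remove_box lam i ! a" if "a < b" "b < length lam" for a b
  proof -
    have "lam ! b \<le> lam ! a" using that assms(1) by (auto simp: sorted_wrt_iff_nth_less)
    then show ?thesis
      using that \<open>i < b \<Longrightarrow> b < length lam \<Longrightarrow> lam ! b < lam ! i\<close>
      by (cases "a = i"; cases "b = i") (simp_all add: remove_box_def)
  qed
  then show ?thesis by (auto simp: sorted_wrt_iff_nth_less remove_box_def)
qed

lemma sum_list_remove_box:
  assumes "i \<in> corner_rows lam"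
  shows "sum_list lam = Suc (sum_list (remove_box lam i))"
proof -
  have "i < length lam" "0 < lam ! i" using assms by (auto simp: corner_rows_def)
  moreover from this have "lam ! i \<le> sum_list lam" by (simp add: member_le_sum_list)
  ultimately show ?thesis by (simp add: remove_box_def sum_list_update)
qed

lemma young_diagram_remove_box:
  assumes "i \<in> corner_rows lam"
  shows "young_diagram (remove_box lam i) = young_diagram lam - {(Suc i, lam ! i)}"
    and "(Suc i, lam ! i) \<in> young_diagram lam"
proof -
  have i: "i < length lam" "0 < lam ! i" using assms by (auto simp: corner_rows_def)
  then show "(Suc i, lam ! i) \<in> young_diagram lam" by (simp add: young_diagram_def part_def)
  have "part (remove_box lam i) a = (if a = Suc i then lam ! i - 1 else part lam a)" for a
    using i by (cases a) (auto simp: part_def remove_box_def nth_list_update)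
  moreover have "part lam (Suc i) = lam ! i" using i by (simp add: part_def)
  ultimately show "young_diagram (remove_box lam i) = young_diagram lam - {(Suc i, lam ! i)}"
    using i by (auto simp: young_diagram_def split: if_splits)
qed

text \<open>Only \<open>x i\<close> changes, and it drops by one. The factorials contribute \<open>x i\<close>, and the
  Vandermonde product contributes the shift quotient.\<close>

lemma hook_product_remove_box:
  assumes "sorted_wrt (\<ge>) lam" "i \<in> corner_rows lam"
  defines "x \<equiv> \<lambda>j. real (beta_number lam j)"
  shows "real (hook_product lam)
         = x i * shift_quotient x ({..<length lam} - {i}) (x i) * real (hook_product (remove_box lam i))"
proof -
  let ?m = "length lam" and ?mu = "remove_box lam i"
  let ?J = "{..<?m} - {i}"
  have i: "i < ?m" "0 < lam ! i" using assms by (auto simp: corner_rows_def)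
  have len: "length ?mu = ?m" by (simp add: remove_box_def)
  have bmu: "beta_number ?mu = (beta_number lam)(i := beta_number lam i - 1)" and pos: "0 < beta_number lam i"
    using i by (auto simp: beta_number_def remove_box_def nth_list_update fun_eq_iff)
  have y: "(\<lambda>j. real (beta_number ?mu j)) = x(i := x i - 1)"
    using pos by (auto simp: bmu x_def fun_eq_iff of_nat_diff)
  let ?V = "vandermonde ?m x" and ?W = "vandermonde ?m (x(i := x i - 1))"
  have V: "0 < ?V"
    using beta_number_strict_decreasing[OF assms(1)] by (intro vandermonde_pos) (auto simp: x_def)
  have W: "0 < ?W"
    using beta_number_strict_decreasing[OF sorted_remove_box[OF assms(1,2)]] unfolding y[symmetric]
    by (intro vandermonde_pos) (auto simp: len)
  have neq: "x i \<noteq> x j" if "j \<in> ?J" for j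
    using beta_number_strict_decreasing[OF assms(1), of i j] beta_number_strict_decreasing[OF assms(1), of j i] that i
    by (cases "i < j") (auto simp: x_def)
  then have nz: "(\<Prod>j\<in>?J. x i - x j) \<noteq> 0" by auto
  have q: "?W = ?V * shift_quotient x ?J (x i)"
    using vandermonde_fun_upd[OF i(1), of x "x i - 1"] nz
    by (simp add: shift_quotient_def prod_dividef field_simps)
  have "(\<Prod>j<?m. fact (beta_number lam j) :: real)
      = fact (beta_number lam i) * (\<Prod>j\<in>?J. fact (beta_number lam j))"
    using i by (subst prod.remove[of _ i]) auto
  moreover have "(\<Prod>j<?m. fact (beta_number ?mu j) :: real)
      = fact (beta_number lam i - 1) * (\<Prod>j\<in>?J. fact (beta_number lam j))"
    using i by (subst prod.remove[of _ i]) (auto simp: bmu intro!: prod.cong)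
  moreover have "fact (beta_number lam i) = x i * (fact (beta_number lam i - 1) :: real)"
    using pos by (simp add: x_def fact_reduce)
  ultimately have "(\<Prod>j<?m. fact (beta_number lam j) :: real) = x i * (\<Prod>j<?m. fact (beta_number ?mu j))"
    by simp
  then have "real (hook_product lam) * ?V = x i * (real (hook_product ?mu) * ?W)"
    using hook_product_beta_number[OF assms(1)] hook_product_beta_number[OF sorted_remove_box[OF assms(1,2)]]
    by (simp add: y len x_def[symmetric])
  then have "real (hook_product lam) * ?V
     = (x i * shift_quotient x ?J (x i) * real (hook_product ?mu)) * ?V"
    by (simp add: q mult_ac)
  then show ?thesis using V by (metis mult_right_cancel less_irrefl)
qed

lemma sum_beta_number:
  "(\<Sum>i<length lam. beta_number lam i) = sum_list lam + length lam * (length lam - 1) div 2"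
proof -
  have "(\<Sum>i<m. m - Suc i) = m * (m - 1) div 2" for m :: nat
    using sum.nat_diff_reindex[of "\<lambda>i. i" m] Sum_Ico_nat[of 0 m]
    by (simp add: atLeast0LessThan)
  then show ?thesis
    unfolding beta_number_def sum.distrib by (simp add: sum_list_sum_nth atLeast0LessThan)
qed

text \<open>The sum over corners may be extended to all rows: if row \<open>i\<close> is not a corner row, then
  either the next row is equally long, so \<open>x i - 1 = x (Suc i)\<close> and the shift quotient vanishes,
  or row \<open>i\<close> is an empty last row and \<open>x i = 0\<close>.\<close>

lemma sum_hook_product_remove_box:
  assumes "sorted_wrt (\<ge>) lam"
  shows "(\<Sum>i\<in>corner_rows lam. real (hook_product lam) / real (hook_product (remove_box lam i)))
         = real (sum_list lam)"
proof -
  let ?m = "length lam"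
  define x where "x = (\<lambda>j. real (beta_number lam j))"
  let ?t = "\<lambda>i. x i * shift_quotient x ({..<?m} - {i}) (x i)"
  have "inj_on (beta_number lam) {..<?m}"
    by (metis (no_types, lifting) inj_onI linorder_neqE_nat less_irrefl lessThan_iff
        beta_number_strict_decreasing[OF assms])
  then have inj: "inj_on x {..<?m}" by (auto simp: x_def inj_on_def)
  have z: "?t i = 0" if i: "i < ?m" "i \<notin> corner_rows lam" for i
  proof (cases "Suc i < ?m")
    case True
    then have "lam ! Suc i \<le> lam ! i" using assms by (auto simp: sorted_wrt_iff_nth_less)
    then have "lam ! Suc i = lam ! i" using i True by (auto simp: corner_rows_def)
    then have "x i - 1 - x (Suc i) = 0" using True by (simp add: x_def beta_number_def of_nat_diff)
    then have "\<exists>j\<in>{..<?m} - {i}. (x i - 1 - x j) / (x i - x j) = 0"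
      using True by (intro bexI[of _ "Suc i"]) auto
    then have "shift_quotient x ({..<?m} - {i}) (x i) = 0"
      by (simp add: shift_quotient_def)
    then show ?thesis by simp
  next
    case False
    then show ?thesis using i by (simp add: corner_rows_def x_def beta_number_def)
  qed
  have "(\<Sum>i\<in>corner_rows lam. real (hook_product lam) / real (hook_product (remove_box lam i)))
      = (\<Sum>i\<in>corner_rows lam. ?t i)"
  proof (rule sum.cong[OF refl])
    fix i assume "i \<in> corner_rows lam"
    then show "real (hook_product lam) / real (hook_product (remove_box lam i)) = ?t i"
      using hook_product_remove_box[OF assms, of i] hook_product_pos[of "remove_box lam i"]
      by (simp add: x_def)
  qed
  also have "\<dots> = (\<Sum>i<?m. ?t i)"
    using z by (intro sum.mono_neutral_left) (auto simp: corner_rows_def)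
  also have "\<dots> = (\<Sum>i<?m. x i) - real (?m * (?m - 1)) / 2"
    using sum_shift_quotient(2)[OF _ inj] by simp
  also have "(\<Sum>i<?m. x i) = real (sum_list lam) + real (?m * (?m - 1)) / 2"
  proof -
    have "(\<Sum>i<?m. x i) = real (\<Sum>i<?m. beta_number lam i)" by (simp add: x_def)
    also have "\<dots> = real (sum_list lam) + real (?m * (?m - 1) div 2)" by (simp only: sum_beta_number of_nat_add)
    also have "real (?m * (?m - 1) div 2) = real (?m * (?m - 1)) / 2"
      using real_of_nat_div[of 2 "?m * (?m - 1)"] by (cases ?m) simp_all
    finally show ?thesis .
  qed
  finally show ?thesis by simp
qed

section \<open>The branching rule and the hook length formula\<close>

lemma finite_standard_tableaux: "finite (standard_tableaux lam)"
proof (rule finite_subset)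
  show "standard_tableaux lam \<subseteq> young_diagram lam \<rightarrow>\<^sub>E {1..sum_list lam}"
    by (auto simp: standard_tableaux_def PiE_def bij_betw_def)
qed (simp add: finite_PiE finite_young_diagram)

lemma part_antimono:
  assumes "sorted_wrt (\<ge>) lam" "1 \<le> a" "a \<le> b"
  shows "part lam b \<le> part lam a"
  using assms by (cases "a = b") (auto simp: part_def sorted_wrt_iff_nth_less)

text \<open>Nothing lies to the right of or below a corner, so the largest entry may be put there.\<close>

lemma extend_tableau:
  assumes "sorted_wrt (\<ge>) lam" "i \<in> corner_rows lam" "T \<in> standard_tableaux (remove_box lam i)"
  shows "T((Suc i, lam ! i) := sum_list lam) \<in> standard_tableaux lam"
proof -
  let ?u = "(Suc i, lam ! i)" and ?n = "sum_list lam" and ?D = "young_diagram lam"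
  let ?T = "T(?u := ?n)"
  note D = young_diagram_remove_box[OF assms(2)]
  have i: "i < length lam" "0 < lam ! i" and corner: "Suc i < length lam \<Longrightarrow> lam ! Suc i < lam ! i"
    using assms by (auto simp: corner_rows_def)
  have n: "{1..?n} = insert ?n {1..sum_list (remove_box lam i)}"
    and n': "?n \<notin> {1..sum_list (remove_box lam i)}"
    using sum_list_remove_box[OF assms(2)] by auto
  have T: "T \<in> extensional (?D - {?u})"
    "bij_betw T (?D - {?u}) {1..sum_list (remove_box lam i)}"
    and rows: "\<And>a b b'. (a, b) \<in> ?D - {?u} \<Longrightarrow> (a, b') \<in> ?D - {?u} \<Longrightarrow> b < b' \<Longrightarrow> T (a, b) < T (a, b')"
    and cols: "\<And>a a' b. (a, b) \<in> ?D - {?u} \<Longrightarrow> (a', b) \<in> ?D - {?u} \<Longrightarrow> a < a' \<Longrightarrow> T (a, b) < T (a', b)"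
    using assms(3) unfolding standard_tableaux_def D(1) by blast+
  have less: "T v < ?n" if "v \<in> ?D - {?u}" for v
    using bij_betw_apply[OF T(2) that] sum_list_remove_box[OF assms(2)] by simp
  have "bij_betw ?T (?D - {?u}) {1..sum_list (remove_box lam i)}"
    using T(2) by (subst bij_betw_cong[where g = T]) auto
  then have "bij_betw ?T (?D - {?u} \<union> {?u}) ({1..sum_list (remove_box lam i)} \<union> {?n})"
    using n' by (intro bij_betw_combine) (auto simp: bij_betw_def)
  moreover have "?D - {?u} \<union> {?u} = ?D" using D(2) by auto
  ultimately have bij: "bij_betw ?T ?D {1..?n}" using n by simp
  have pi: "part lam (Suc i) = lam ! i" using i by (simp add: part_def)
  have row: "b \<le> lam ! i" if "(Suc i, b) \<in> ?D" for b
    using that pi by (auto simp: young_diagram_def)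
  have col: "a \<le> Suc i" if "(a, lam ! i) \<in> ?D" for a
  proof (rule ccontr)
    assume "\<not> a \<le> Suc i"
    then have "part lam a \<le> part lam (Suc (Suc i))" by (intro part_antimono assms) auto
    moreover have "part lam (Suc (Suc i)) < lam ! i" using corner i by (auto simp: part_def)
    ultimately show False using that by (auto simp: young_diagram_def)
  qed
  have "?T (a, b) < ?T (a, b')" if "(a, b) \<in> ?D" "(a, b') \<in> ?D" "b < b'" for a b b'
    using that rows[of a b b'] less[of "(a, b)"] row[of b'] by auto
  moreover have "?T (a, b) < ?T (a', b)" if "(a, b) \<in> ?D" "(a', b) \<in> ?D" "a < a'" for a a' b
    using that cols[of a b a'] less[of "(a, b)"] col[of a'] by auto
  moreover have "?T \<in> extensional ?D" using T(1) D(2) by (auto simp: extensional_def)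
  ultimately show ?thesis using bij by (auto simp: standard_tableaux_def)
qed

text \<open>A box to the right of or below the largest entry would need a larger entry, so the
  largest entry sits in a corner.\<close>

lemma tableau_last_entry:
  assumes "sorted_wrt (\<ge>) lam" "0 < sum_list lam" "T \<in> standard_tableaux lam"
  obtains i where "i \<in> corner_rows lam" "T (Suc i, lam ! i) = sum_list lam"
    "restrict T (young_diagram (remove_box lam i)) \<in> standard_tableaux (remove_box lam i)"
proof -
  let ?n = "sum_list lam" and ?D = "young_diagram lam"
  have T: "bij_betw T ?D {1..?n}"
    and rows: "\<And>a b b'. (a, b) \<in> ?D \<Longrightarrow> (a, b') \<in> ?D \<Longrightarrow> b < b' \<Longrightarrow> T (a, b) < T (a, b')"
    and cols: "\<And>a a' b. (a, b) \<in> ?D \<Longrightarrow> (a', b) \<in> ?D \<Longrightarrow> a < a' \<Longrightarrow> T (a, b) < T (a', b)"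
    using assms(3) unfolding standard_tableaux_def by blast+
  have le: "T v \<le> ?n" if "v \<in> ?D" for v using T that by (force simp: bij_betw_def)
  have "?n \<in> T ` ?D" using T assms(2) by (auto simp: bij_betw_def)
  then obtain a b where u: "(a, b) \<in> ?D" "T (a, b) = ?n" by auto
  then have ab: "1 \<le> a" "1 \<le> b" "b \<le> part lam a" by (auto simp: young_diagram_def)
  then obtain i where i: "a = Suc i" "i < length lam"
    by (cases a) (auto simp: part_def split: if_splits)
  have pi: "part lam a = lam ! i" using i by (simp add: part_def)
  have "(a, Suc b) \<notin> ?D" using rows[of a b "Suc b"] le[of "(a, Suc b)"] u by force
  then have b: "b = lam ! i" using ab pi by (auto simp: young_diagram_def)
  have "(Suc a, b) \<notin> ?D" using cols[of a b "Suc a"] le[of "(Suc a, b)"] u by force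
  then have c: "i \<in> corner_rows lam" using ab i b
    by (auto simp: corner_rows_def young_diagram_def part_def split: if_splits)
  note D = young_diagram_remove_box[OF c]
  have "bij_betw T (?D - {(a, b)}) ({1..?n} - {?n})"
    by (rule bij_betw_DiffI[OF T]) (use u assms(2) in \<open>auto simp: bij_betw_def\<close>)
  moreover have "{1..?n} - {?n} = {1..sum_list (remove_box lam i)}"
    using sum_list_remove_box[OF c] by auto
  ultimately have "bij_betw (restrict T (?D - {(a, b)})) (?D - {(a, b)}) {1..sum_list (remove_box lam i)}"
    by (simp add: bij_betw_restrict_eq)
  then have "restrict T (young_diagram (remove_box lam i)) \<in> standard_tableaux (remove_box lam i)"
    using rows cols by (auto simp: standard_tableaux_def D(1) i b)
  then show thesis using that c u i b by auto
qed

text \<open>Tableaux are sorted by the corner that holds their largest entry.\<close>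

lemma num_SYT_branching:
  assumes "sorted_wrt (\<ge>) lam" "0 < sum_list lam"
  shows "num_SYT lam = (\<Sum>i\<in>corner_rows lam. num_SYT (remove_box lam i))"
proof -
  let ?u = "\<lambda>i. (Suc i, lam ! i)" and ?n = "sum_list lam"
  let ?E = "\<lambda>i. (\<lambda>T. T(?u i := ?n)) ` standard_tableaux (remove_box lam i)"
  have "standard_tableaux lam = (\<Union>i\<in>corner_rows lam. ?E i)"
  proof
    show "standard_tableaux lam \<subseteq> (\<Union>i\<in>corner_rows lam. ?E i)"
    proof
      fix T assume T: "T \<in> standard_tableaux lam"
      then obtain i where i: "i \<in> corner_rows lam" "T (?u i) = ?n"
        "restrict T (young_diagram (remove_box lam i)) \<in> standard_tableaux (remove_box lam i)"
        using tableau_last_entry[OF assms] by blast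
      have "T \<in> extensional (young_diagram lam)" using T by (simp add: standard_tableaux_def)
      then have "T = (restrict T (young_diagram (remove_box lam i)))(?u i := ?n)"
        using i(2) young_diagram_remove_box[OF i(1)]
        by (auto simp: fun_eq_iff extensional_def)
      then show "T \<in> (\<Union>i\<in>corner_rows lam. ?E i)" using i by blast
    qed
    show "(\<Union>i\<in>corner_rows lam. ?E i) \<subseteq> standard_tableaux lam"
      using extend_tableau[OF assms(1)] by auto
  qed
  moreover have "?E i \<inter> ?E j = {}" if ij: "i \<in> corner_rows lam" "j \<in> corner_rows lam" "i \<noteq> j" for i j
  proof (rule ccontr)
    assume "?E i \<inter> ?E j \<noteq> {}"
    then obtain S where S: "S \<in> ?E i" "S \<in> ?E j" by blast
    then have "S \<in> standard_tableaux lam" using extend_tableau[OF assms(1) ij(1)] by auto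
    then have "inj_on S (young_diagram lam)" by (auto simp: standard_tableaux_def bij_betw_def)
    moreover have "S (?u l) = ?n" if "S \<in> ?E l" for l using that by auto
    note this[OF S(1)] this[OF S(2)]
    ultimately have "?u i = ?u j"
      using young_diagram_remove_box(2)[OF ij(1)] young_diagram_remove_box(2)[OF ij(2)]
      by (metis inj_onD)
    then show False using ij by simp
  qed
  moreover have "card (?E i) = num_SYT (remove_box lam i)" if "i \<in> corner_rows lam" for i
  proof -
    have "inj_on (\<lambda>T. T(?u i := ?n)) (standard_tableaux (remove_box lam i))"
    proof (rule inj_onI)
      fix S T assume ST: "S \<in> standard_tableaux (remove_box lam i)"
        "T \<in> standard_tableaux (remove_box lam i)" and eq: "S(?u i := ?n) = T(?u i := ?n)"
      have "?u i \<notin> young_diagram (remove_box lam i)"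
        using young_diagram_remove_box(1)[OF that] by simp
      \<comment> \<open>The overwritten values agree because tableaux are undefined outside their diagram.\<close>
      then have "S (?u i) = undefined" "T (?u i) = undefined"
        using ST by (auto simp: standard_tableaux_def extensional_def)
      then show "S = T" using eq by (metis fun_upd_triv fun_upd_upd)
    qed
    then show ?thesis by (simp add: card_image num_SYT_def)
  qed
  moreover have "finite (corner_rows lam)" by (simp add: corner_rows_def)
  ultimately show ?thesis
    unfolding num_SYT_def[of lam]
    by (simp add: card_UN_disjoint finite_standard_tableaux)
qed

theorem hook_length_formula:
  assumes "sorted_wrt (\<ge>) lam"
  shows "real (num_SYT lam) * real (hook_product lam) = fact (sum_list lam)"
  using assms
proof (induction "sum_list lam" arbitrary: lam)
  case 0
  have "young_diagram lam = {}"
  proof -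
    have "part lam i = 0" for i using 0(1) by (auto simp: part_def)
    then show ?thesis by (auto simp: young_diagram_def)
  qed
  then have "hook_product lam = 1" "standard_tableaux lam = {\<lambda>_. undefined}"
    using 0(1) by (auto simp: hook_product_def standard_tableaux_def bij_betw_def)
  then show ?case unfolding 0(1)[symmetric] by (simp add: num_SYT_def)
next
  case (Suc n)
  have pos: "0 < real (hook_product mu)" for mu using hook_product_pos[of mu] by simp
  have "real (num_SYT (remove_box lam i)) = fact n / real (hook_product (remove_box lam i))"
    if "i \<in> corner_rows lam" for i
  proof -
    have "n = sum_list (remove_box lam i)" using sum_list_remove_box[OF that] Suc.hyps(2) by simp
    then show ?thesis
      using Suc.hyps(1)[OF _ sorted_remove_box[OF Suc.prems that]] pos[of "remove_box lam i"]
      by (simp add: field_simps)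
  qed
  then have "real (num_SYT lam)
      = (\<Sum>i\<in>corner_rows lam. fact n / real (hook_product (remove_box lam i)))"
    using num_SYT_branching[OF Suc.prems] Suc.hyps(2) by simp
  then have "real (num_SYT lam) * real (hook_product lam)
      = fact n * (\<Sum>i\<in>corner_rows lam. real (hook_product lam) / real (hook_product (remove_box lam i)))"
    by (simp add: sum_distrib_left sum_distrib_right)
  also have "\<dots> = fact n * real (Suc n)"
    using sum_hook_product_remove_box[OF Suc.prems] Suc.hyps(2) by simp
  finally show ?case using Suc.hyps(2)[symmetric] by simp
qed

section \<open>Staircases\<close>

text \<open>The index \<open>i\<close> counts the new rows from the bottom: the leg of a box in row \<open>i\<close> consists of
  \<open>i\<close> new boxes and a column of \<open>xs\<close>.\<close>

lemma hook_product_replicate_append: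
  assumes "\<And>y. y \<in> set xs \<Longrightarrow> y \<le> x"
  shows "hook_product (replicate t x @ xs)
       = (\<Prod>i<t. \<Prod>j=1..x. x - j + (i + conj_part xs j) + 1) * hook_product xs"
proof (induction t)
  case 0
  then show ?case by simp
next
  case (Suc t)
  have "conj_part (replicate t x @ xs) j = t + conj_part xs j" if "j \<in> {1..x}" for j
    using that by (simp add: conj_part_eq_filter)
  moreover have "hook_product (x # (replicate t x @ xs))
    = (\<Prod>j=1..x. x - j + conj_part (replicate t x @ xs) j + 1) * hook_product (replicate t x @ xs)"
    using assms by (intro hook_product_Cons) auto
  ultimately show ?case using Suc by simp
qed

text \<open>The columns \<open>w q + 1, \<dots>, w q + w\<close> meet exactly the rows of length \<open>w m\<close> with
  \<open>q < m < k\<close>. Blocks of columns are indexed from the right, \<open>r = k - 1 - q\<close>, because then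
  the height \<open>s r\<close> depends only on \<open>r\<close>.\<close>

lemma conj_part_gen_staircase:
  assumes "r < k" "j \<in> {1..w}"
  shows "conj_part (gen_staircase w s k) (w * (k - 1 - r) + j) = s * r"
proof -
  \<comment> \<open>Proved for a fixed \<open>q\<close> so that an induction on \<open>k\<close> is possible.\<close>
  have "length (filter (\<lambda>x. w * q + j \<le> x) (gen_staircase w s k)) = s * (k - 1 - q)" for q
  proof (induction k)
    case 0
    then show ?case by (simp add: gen_staircase_def)
  next
    case (Suc k)
    have iff: "w * q + j \<le> w * k \<longleftrightarrow> q < k"
    proof
      assume "w * q + j \<le> w * k"
      then have "w * q < w * k" using assms(2) unfolding atLeastAtMost_iff by linarith
      then show "q < k" by simp
    next
      assume "q < k"
      then have "w * Suc q \<le> w * k" by (intro mult_le_mono2) simp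
      then show "w * q + j \<le> w * k" using assms by simp
    qed
    show ?case
    proof (cases "k = 0")
      case True
      then show ?thesis by (simp add: gen_staircase_def)
    next
      case False
      moreover have "s + s * (k - 1 - q) = s * (k - q)" if "q < k"
      proof -
        have "k - q = Suc (k - 1 - q)" using that by simp
        then show ?thesis by simp
      qed
      ultimately show ?thesis using Suc iff by (auto simp: gen_staircase_Suc)
    qed
  qed
  from this[of "k - 1 - r"] show ?thesis using assms by (simp add: conj_part_eq_filter)
qed

lemma prod_blocks:
  fixes g :: "nat \<Rightarrow> 'a::comm_monoid_mult"
  shows "(\<Prod>j=1..w * k. g j) = (\<Prod>q<k. \<Prod>j=1..w. g (w * q + j))"
proof (induction k)
  case 0
  then show ?case by simp
next
  case (Suc k)
  have "{1..w * Suc k} = {1..w * k} \<union> (\<lambda>j. w * k + j) ` {1..w}"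
    by (auto simp: image_add_atLeastAtMost)
  then have "(\<Prod>j=1..w * Suc k. g j) = (\<Prod>j=1..w * k. g j) * prod g ((\<lambda>j. w * k + j) ` {1..w})"
    by (simp only:) (rule prod.union_disjoint; auto)
  also have "prod g ((\<lambda>j. w * k + j) ` {1..w}) = (\<Prod>j=1..w. g (w * k + j))"
    by (subst prod.reindex) auto
  finally show ?case using Suc by simp
qed

lemma gen_staircase_le:
  assumes "y \<in> set (gen_staircase w s k)"
  shows "y \<le> w * k"
  using assms by (auto simp: gen_staircase_def)

text \<open>In a new row, the box in column \<open>w + 1 - j\<close> of block \<open>r\<close>, counted from the right, has arm
  \<open>w r + j - 1\<close>, and its leg is \<open>s r\<close> plus the number of new rows below it. Both the
  rows and the columns inside a block are reversed to reach the stated form.\<close>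

lemma hook_product_gen_staircase_Suc:
  assumes "k > 0"
  shows "hook_product (gen_staircase w s (Suc k))
       = (\<Prod>r<k. \<Prod>i=1..s. \<Prod>j=1..w. (s - i) + j + (w + s) * r) * hook_product (gen_staircase w s k)"
proof -
  let ?c = "conj_part (gen_staircase w s k)"
  have hook: "w * k - (w * (k - 1 - r) + (w + 1 - j)) + (i + ?c (w * (k - 1 - r) + (w + 1 - j))) + 1
      = i + j + (w + s) * r" if "r < k" "j \<in> {1..w}" for i j r
  proof -
    have "?c (w * (k - 1 - r) + (w + 1 - j)) = s * r"
      using that by (intro conj_part_gen_staircase) auto
    moreover have "w * k = w * (k - 1 - r) + w + w * r"
    proof -
      have "k = (k - 1 - r) + 1 + r" using that by simp
      then show ?thesis by (metis distrib_left mult.right_neutral)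
    qed
    ultimately show ?thesis using that by (simp add: distrib_right)
  qed
  have "(\<Prod>i<s. \<Prod>j=1..w * k. w * k - j + (i + ?c j) + 1)
      = (\<Prod>i<s. \<Prod>r<k. \<Prod>j=1..w. i + j + (w + s) * r)"
  proof (rule prod.cong[OF refl])
    fix i
    have "(\<Prod>j=1..w * k. w * k - j + (i + ?c j) + 1)
        = (\<Prod>r<k. \<Prod>j=1..w. w * k - (w * (k - 1 - r) + j) + (i + ?c (w * (k - 1 - r) + j)) + 1)"
      unfolding prod_blocks by (subst prod.nat_diff_reindex[symmetric]) simp
    also have "\<dots> = (\<Prod>r<k. \<Prod>j=1..w. i + j + (w + s) * r)"
    proof (rule prod.cong[OF refl])
      fix r assume "r \<in> {..<k}"
      then show "(\<Prod>j=1..w. w * k - (w * (k - 1 - r) + j) + (i + ?c (w * (k - 1 - r) + j)) + 1)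
          = (\<Prod>j=1..w. i + j + (w + s) * r)"
        using hook[of r _ i]
        by (subst prod.atLeastAtMost_rev) (auto intro!: prod.cong)
    qed
    finally show "(\<Prod>j=1..w * k. w * k - j + (i + ?c j) + 1)
        = (\<Prod>r<k. \<Prod>j=1..w. i + j + (w + s) * r)" .
  qed
  also have "\<dots> = (\<Prod>r<k. \<Prod>i<s. \<Prod>j=1..w. i + j + (w + s) * r)"
    by (rule prod.swap)
  also have "\<dots> = (\<Prod>r<k. \<Prod>i=1..s. \<Prod>j=1..w. (s - i) + j + (w + s) * r)"
  proof (rule prod.cong[OF refl])
    fix r
    show "(\<Prod>i<s. \<Prod>j=1..w. i + j + (w + s) * r)
        = (\<Prod>i=1..s. \<Prod>j=1..w. (s - i) + j + (w + s) * r)"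
      by (rule prod.reindex_bij_witness[where i = "\<lambda>i. s - i" and j = "\<lambda>i. s - i"]) auto
  qed
  finally show ?thesis
    using assms gen_staircase_le by (simp add: gen_staircase_Suc hook_product_replicate_append)
qed

lemma sum_list_gen_staircase: "sum_list (gen_staircase w s k) = (w * s * k * (k - 1)) div 2"
proof -
  have "2 * sum_list (gen_staircase w s k) = w * s * k * (k - 1)"
  proof (induction k)
    case 0
    then show ?case by (simp add: gen_staircase_def)
  next
    case (Suc k)
    show ?case
    proof (cases k)
      case 0
      then show ?thesis by (simp add: gen_staircase_def)
    next
      case (Suc m)
      with Suc.IH show ?thesis
        by (simp add: gen_staircase_Suc sum_list_replicate algebra_simps)
    qed
  qed
  then show ?thesis by simp
qed

theorem proposition7p15:
  fixes k w s :: nat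
  assumes "k > 0" and "w > 0" and "s > 0"
  shows "real (hook_product (gen_staircase w s (k + 1))) / real (hook_product (gen_staircase w s k))
           = (\<Prod>r=0..k-1. \<Prod>i=1..s. \<Prod>j=1..w.
                real s - real i + real j + (real w + real s) * real r)
         \<and> real (num_SYT (gen_staircase w s (k + 1))) / real (num_SYT (gen_staircase w s k))
           = fact ((w * s * k * (k + 1)) div 2) / fact ((w * s * k * (k - 1)) div 2)
             * (\<Prod>r=0..k-1. \<Prod>i=1..s. \<Prod>j=1..w.
                  1 / (real s - real i + real j + (real w + real s) * real r))"
proof -
  let ?H = "\<lambda>k. real (hook_product (gen_staircase w s k))"
  let ?f = "\<lambda>k. real (num_SYT (gen_staircase w s k))"
  let ?P = "\<Prod>r=0..k-1. \<Prod>i=1..s. \<Prod>j=1..w. real s - real i + real j + (real w + real s) * real r"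
  have pos: "0 < ?H k'" for k' using hook_product_pos by simp
  have "{0..k-1} = {..<k}" using assms by auto
  then have "?H (Suc k) = ?P * ?H k"
    using assms(1) by (simp add: hook_product_gen_staircase_Suc of_nat_diff algebra_simps)
  then have H: "?H (Suc k) / ?H k = ?P" using pos[of k] by simp
  have hlf: "?f k' = fact ((w * s * k' * (k' - 1)) div 2) / ?H k'" for k'
  proof -
    have "sorted_wrt (\<ge>) (gen_staircase w s k')"
      using is_partition_gen_staircase[OF assms(2)] by (simp add: is_partition_def)
    from hook_length_formula[OF this] show ?thesis
      using pos[of k'] by (simp add: field_simps sum_list_gen_staircase)
  qed
  have "?f (Suc k) / ?f k
      = fact ((w * s * Suc k * k) div 2) / fact ((w * s * k * (k - 1)) div 2) * (1 / (?H (Suc k) / ?H k))"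
    by (simp add: hlf)
  also have "w * s * Suc k * k = w * s * k * (k + 1)" by (simp add: algebra_simps)
  also have "1 / (?H (Suc k) / ?H k) = (\<Prod>r=0..k-1. \<Prod>i=1..s. \<Prod>j=1..w.
                  1 / (real s - real i + real j + (real w + real s) * real r))"
    unfolding H by (simp add: prod_dividef)
  finally show ?thesis using H by simp
qed

end
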